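(* Let $f : \mathbb{R}^4 \to \mathbb{R}$ be a function satisfying the functional equation $$\begin{aligned} f(x_1, y_1, z_1, w_1)\, f(x_2, y_2, z_2, w_2) = f(&x_1 x_2 + y_1 y_2 + z_1 z_2 + w_1 w_2,\\ &x_1 y_2 - y_1 x_2 + z_1 w_2 - w_1 z_2,\\ &x_1 z_2 - y_1 w_2 - z_1 x_2 + w_1 y_2,\\ &x_1 w_2 + y_1 z_2 - z_1 y_2 - w_1 x_2) \end{aligned}$$ for all $x_i, y_i, z_i, w_i \in \mathbb{R}$ $(i = 1, 2)$. Then there exist a multiplicative function $m : \mathbb{R} \to \mathbb{R}$ and a function $\sigma : \mathbb{R}^4 \to \{-1, +1\}$ such that $$f(x, y, z, w) = \sigma(x, y, z, w)\, m\left(\sqrt{x^2 + y^2 + z^2 + w^2}\right)$$ for all real numbers $x, y, z, w$.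
   Context: A function $m : \mathbb{R} \to \mathbb{R}$ is called multiplicative if $m(xy) = m(x)m(y)$ for all $x, y \in \mathbb{R}$. The function $\sigma$ (called a signum function) is an arbitrary function with values in $\{-1,+1\}$. *)

theory Defs
  imports Complex_Main
begin

definition multiplicative :: "(real \<Rightarrow> real) \<Rightarrow> bool" where
  "multiplicative m \<longleftrightarrow> (\<forall>x y. m (x * y) = m x * m y)"

definition signum_function :: "('a \<Rightarrow> real) \<Rightarrow> bool" where
  "signum_function \<sigma> \<longleftrightarrow> range \<sigma> \<subseteq> {-1, 1}"

end

theory Submission
  imports Defs
begin

text \<open>
  Read \<open>(x, y, z, w)\<close> as the quaternion \<open>x + y i + z j + w k\<close>. The argument on the right of the
  functional equation is then \<open>q\<^sub>2 \<cdot> conj q\<^sub>1\<close>, so the equation for \<open>q\<^sub>1 = q\<^sub>2 = q\<close> involves only the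
  real quaternion \<open>q \<cdot> conj q = |q|\<^sup>2\<close>: it says \<open>(f q)\<^sup>2 = f (|q|\<^sup>2)\<close>. On real quaternions conjugation is
  trivial, so the restriction \<open>m\<close> of \<open>f\<close> to the real axis is multiplicative, whence
  \<open>(f q)\<^sup>2 = m (|q|\<^sup>2) = (m |q|)\<^sup>2\<close>. Thus \<open>f q\<close> and \<open>m |q|\<close> agree up to a sign, which is \<open>\<sigma> q\<close>.
\<close>


theorem theorem4:
  fixes f :: "real \<times> real \<times> real \<times> real \<Rightarrow> real"
  assumes "\<And>x1 y1 z1 w1 x2 y2 z2 w2 :: real.
    f (x1, y1, z1, w1) * f (x2, y2, z2, w2) =
      f (x1 * x2 + y1 * y2 + z1 * z2 + w1 * w2,
         x1 * y2 - y1 * x2 + z1 * w2 - w1 * z2,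
         x1 * z2 - y1 * w2 - z1 * x2 + w1 * y2,
         x1 * w2 + y1 * z2 - z1 * y2 - w1 * x2)"
  shows "\<exists>(m :: real \<Rightarrow> real) (\<sigma> :: real \<times> real \<times> real \<times> real \<Rightarrow> real).
    multiplicative m \<and> signum_function \<sigma> \<and>
    (\<forall>x y z w. f (x, y, z, w) = \<sigma> (x, y, z, w) * m (sqrt (x\<^sup>2 + y\<^sup>2 + z\<^sup>2 + w\<^sup>2)))"
proof -
  define m where "m t = f (t, 0, 0, 0)" for t
  define N where "N = (\<lambda>(x, y, z, w). sqrt (x\<^sup>2 + y\<^sup>2 + z\<^sup>2 + w\<^sup>2) :: real)"
  define \<sigma> :: "real \<times> real \<times> real \<times> real \<Rightarrow> real"
    where "\<sigma> q = (if f q = m (N q) then 1 else - 1)" for q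
  have m_mult: "m (s * t) = m s * m t" for s t
    using assms[of s 0 0 0 t 0 0 0] by (simp add: m_def)
  have square: "(f (x, y, z, w))\<^sup>2 = (m (N (x, y, z, w)))\<^sup>2" for x y z w
  proof -
    have "(f (x, y, z, w))\<^sup>2 = m (x\<^sup>2 + y\<^sup>2 + z\<^sup>2 + w\<^sup>2)"
      using assms[of x y z w x y z w] by (simp add: m_def power2_eq_square mult.commute)
    also have "x\<^sup>2 + y\<^sup>2 + z\<^sup>2 + w\<^sup>2 = N (x, y, z, w) * N (x, y, z, w)"
      by (simp add: N_def)
    finally show ?thesis
      by (simp add: m_mult power2_eq_square)
  qed
  have "f (x, y, z, w) = \<sigma> (x, y, z, w) * m (N (x, y, z, w))" for x y z w
    using square[of x y z w] by (auto simp: \<sigma>_def power2_eq_iff)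
  moreover have "multiplicative m"
    by (simp add: multiplicative_def m_mult)
  moreover have "signum_function \<sigma>"
    by (auto simp: signum_function_def \<sigma>_def)
  ultimately show ?thesis
    unfolding N_def by auto
qed

end
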